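(* Let $X$ be a topological space such that $|X|\geq cov(\mathcal M)$. Then $X$ is not R-nw-selective.
   Context: A network for a space $X$ is a family $\mathcal N$ of subsets of $X$ such that for every $x\in X$ and every open neighbourhood $U$ of $x$ there is $N\in\mathcal N$ with $x\in N\subseteq U$. The net weight $nw(X)$ is the least cardinality of a network for $X$; $nw(X)=\omega$ is understood as: $X$ has a countable network. A space $X$ is R-nw-selective if $nw(X)=\omega$ and for every sequence $(\mathcal N_n:n\in\omega)$ of countable networks for $X$ one can pick $N_n\in\mathcal N_n$, $n\in\omega$, such that $\{N_n:n\in\omega\}$ is a network for $X$. $\mathcal M$ is the family of meager subsets of $\mathbb R$ and $cov(\mathcal M)$ is the minimal cardinality of a subfamily $\mathcal U\subseteq\mathcal M$ with $\bigcup\mathcal U=\mathbb R$. *)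

theory Defs
  imports "HOL-Analysis.Analysis"
begin

unbundle cardinal_syntax

definition nowhere_dense_in :: "'a topology \<Rightarrow> 'a set \<Rightarrow> bool" where
  "nowhere_dense_in X A \<longleftrightarrow>
     A \<subseteq> topspace X \<and> X interior_of (X closure_of A) = {}"

definition meager_in :: "'a topology \<Rightarrow> 'a set \<Rightarrow> bool" where
  "meager_in X A \<longleftrightarrow>
     (\<exists>F. countable F \<and> (\<forall>B\<in>F. nowhere_dense_in X B) \<and> A = \<Union>F)"

definition meager_cover :: "real set set \<Rightarrow> bool" where
  "meager_cover U \<longleftrightarrow> (\<forall>A\<in>U. meager_in euclidean A) \<and> \<Union>U = UNIV"

(* Cardinals are represented by cardinal orders, as in the library. The choice below is unique
   only up to order isomorphism (=o); cov_meager_attained and cov_meager_le show that it exists. *)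
definition cov_meager :: "real set rel" where
  "cov_meager = (SOME r. r \<in> card_of ` Collect meager_cover \<and>
                         (\<forall>r' \<in> card_of ` Collect meager_cover. r \<le>o r'))"

lemma meager_cover_singletons: "meager_cover (range (\<lambda>x. {x}))"
proof -
  have "nowhere_dense_in euclidean {x}" for x :: real
    by (simp add: nowhere_dense_in_def)
  then have "meager_in euclidean {x}" for x :: real
    unfolding meager_in_def by (intro exI[of _ "{{x}}"]) simp
  then show ?thesis
    by (auto simp: meager_cover_def)
qed

lemma cov_meager_least:
  "cov_meager \<in> card_of ` Collect meager_cover \<and>
   (\<forall>r' \<in> card_of ` Collect meager_cover. cov_meager \<le>o r')"
proof -
  have "\<exists>r \<in> card_of ` Collect meager_cover. \<forall>r' \<in> card_of ` Collect meager_cover. r \<le>o r'"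
    by (rule exists_minim_Card_order) (use meager_cover_singletons in \<open>auto simp: card_of_Card_order\<close>)
  then show ?thesis
    unfolding cov_meager_def Bex_def by (rule someI_ex)
qed

lemma cov_meager_attained: "\<exists>U. meager_cover U \<and> cov_meager = |U|"
  using cov_meager_least by blast

lemma cov_meager_le: "meager_cover U \<Longrightarrow> cov_meager \<le>o |U|"
  using cov_meager_least by blast

definition network :: "'a topology \<Rightarrow> 'a set set \<Rightarrow> bool" where
  "network X \<N> \<longleftrightarrow>
     (\<forall>N\<in>\<N>. N \<subseteq> topspace X) \<and>
     (\<forall>x\<in>topspace X. \<forall>U. openin X U \<and> x \<in> U \<longrightarrow> (\<exists>N\<in>\<N>. x \<in> N \<and> N \<subseteq> U))"

(* The first conjunct is nw(X) = omega, in the sense that X has a countable network.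
   As in the library, countable sets may be finite. *)
definition R_nw_selective :: "'a topology \<Rightarrow> bool" where
  "R_nw_selective X \<longleftrightarrow>
     (\<exists>\<N>. countable \<N> \<and> network X \<N>) \<and>
     (\<forall>\<N> :: nat \<Rightarrow> 'a set set.
        (\<forall>n. countable (\<N> n) \<and> network X (\<N> n)) \<longrightarrow>
        (\<exists>N. (\<forall>n. N n \<in> \<N> n) \<and> network X (range N)))"

end

theory Submission
  imports Defs "HOL-Library.Countable_Set_Type"
begin

text \<open>
  Let \<open>X\<close> be R-nw-selective. For functions \<open>f x :: nat \<Rightarrow> nat\<close> indexed by the points \<open>x\<close> of \<open>X\<close>, cutting
  each member of a countable network along the fibres of \<open>\<lambda>x. f x n\<close> gives a countable network,
  for every \<open>n\<close>. A member of the \<open>n\<close>-th network lies in one fibre \<open>{x. f x n = g n}\<close>, and the members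
  selected cover \<open>X\<close>; hence the single function \<open>g\<close> agrees somewhere with every \<open>f x\<close>
  (\<open>R_nw_selective_guessable\<close>).

  It remains to see that such guessing is impossible for \<open>cov(M)\<close> many functions. This is the harder
  half of Bartoszynski's combinatorial description of \<open>cov(M)\<close>: if a family \<open>J\<close> of nowhere dense
  sets of reals is small enough for guessing, then \<open>J\<close> does not cover the line
  (\<open>guessable_nowhere_dense_not_cover\<close>). The missing real is built from dyadic digits in blocks.
  For \<open>B \<in> J\<close> and each position \<open>n\<close> there is a finite string of digits which, placed at \<open>n\<close> after any
  \<open>n\<close> digits whatsoever, leads into a dyadic interval that misses \<open>B\<close>. A first guess provides one
  sequence of block boundaries such that, for every \<open>B \<in> J\<close>, infinitely many blocks have room for
  that string (\<open>guessable_interval_partition\<close>). A second guess fills the blocks so that every \<open>B\<close>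
  finds its string in one of its roomy blocks (\<open>guessable_on_infinite_sets\<close>).

  Given a cover of the line by \<open>cov(M)\<close> meager sets, the nowhere dense sets composing them are at
  most \<open>|X|\<close> many if \<open>X\<close> is infinite, and countably many otherwise. In both cases guessing works for
  them, a contradiction.
\<close>

section \<open>Families of functions met by a single function\<close>

text \<open>
  This depends on the cardinality of \<open>I\<close> only. For infinite \<open>I\<close> it means \<open>|I| < cov(M)\<close>, by
  Bartoszynski's theorem.
\<close>

definition guessable :: "'i set \<Rightarrow> bool" where
  "guessable I \<longleftrightarrow> (\<forall>f :: 'i \<Rightarrow> nat \<Rightarrow> nat. \<exists>g. \<forall>i\<in>I. \<exists>n. f i n = g n)"

text \<open>
  Finite sequences may thus be guessed in place of numbers, which is how a single guess can take
  care of several positions.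
\<close>

lemma guessable_countable_values:
  fixes f :: "'i \<Rightarrow> nat \<Rightarrow> 'v::countable"
  assumes "guessable I"
  shows "\<exists>g. \<forall>i\<in>I. \<exists>n. f i n = g n"
proof -
  obtain g where g: "\<forall>i\<in>I. \<exists>n. to_nat (f i n) = g n"
    using assms unfolding guessable_def by (elim allE[of _ "\<lambda>i n. to_nat (f i n)"]) blast
  then have "\<forall>i\<in>I. \<exists>n. f i n = from_nat (g n)"
    by (metis from_nat_to_nat)
  then show ?thesis
    by (intro exI[of _ "\<lambda>n. from_nat (g n)"])
qed

lemma guessable_card_le:
  assumes "guessable I" and "|J| \<le>o |I|"
  shows "guessable J"
  unfolding guessable_def
proof
  fix f :: "_ \<Rightarrow> nat \<Rightarrow> nat"
  obtain e where e: "inj_on e J" "e ` J \<subseteq> I"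
    using assms(2) by (auto simp: card_of_ordLeq[symmetric])
  obtain g where g: "\<forall>i\<in>I. \<exists>n. f (inv_into J e i) n = g n"
    using assms(1) unfolding guessable_def by (elim allE[of _ "\<lambda>i. f (inv_into J e i)"]) blast
  have "\<exists>n. f j n = g n" if "j \<in> J" for j
    using g e that by (metis image_subset_iff inv_into_f_f)
  then show "\<exists>g. \<forall>j\<in>J. \<exists>n. f j n = g n"
    by blast
qed

text \<open>
  A diagonal function meets the \<open>n\<close>-th of countably many functions at \<open>n\<close>. The case of finite spaces
  rests on this.
\<close>

lemma guessable_countable:
  assumes "countable I"
  shows "guessable I"
  unfolding guessable_def
proof (intro allI exI ballI)
  fix f :: "'a \<Rightarrow> nat \<Rightarrow> nat" and i
  assume "i \<in> I"
  then show "f i (to_nat_on I i) = (\<lambda>n. f (from_nat_into I n) n) (to_nat_on I i)"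
    using assms by simp
qed

section \<open>Block boundaries\<close>

text \<open>
  Guessing all translates \<open>\<lambda>n. f i n + l\<close> shows that the difference \<open>g n - f i n\<close> takes every natural
  number as a value, so it is nonnegative at infinitely many places.
\<close>

lemma guessable_undominated:
  fixes f :: "'i \<Rightarrow> nat \<Rightarrow> nat"
  assumes "guessable (I \<times> (UNIV :: nat set))"
  shows "\<exists>g. \<forall>i\<in>I. infinite {n. f i n \<le> g n}"
proof -
  obtain g where g: "\<forall>(i, l) \<in> I \<times> (UNIV :: nat set). \<exists>n. f i n + l = g n"
    using assms unfolding guessable_def
    by (elim allE[of _ "\<lambda>(i, l) n. f i n + l"]) (auto simp: split_beta)
  have "infinite {n. f i n \<le> g n}" if "i \<in> I" for i
  proof
    assume fin: "finite {n. f i n \<le> g n}"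
    have "l \<in> (\<lambda>n. g n - f i n) ` {n. f i n \<le> g n}" for l
    proof -
      obtain n where "f i n + l = g n"
        using g \<open>i \<in> I\<close> by blast
      then show ?thesis
        by (intro image_eqI[of _ _ n]) auto
    qed
    then have "(UNIV :: nat set) \<subseteq> (\<lambda>n. g n - f i n) ` {n. f i n \<le> g n}"
      by blast
    then show False
      using fin finite_surj infinite_UNIV_nat by blast
  qed
  then show ?thesis
    by blast
qed

text \<open>
  The sequence \<open>r\<close> is obtained by iterating a function \<open>G\<close> that lies above an undominated \<open>g\<close>. If a
  place \<open>m\<close> in \<open>[r n, r (n + 1))\<close> is known to satisfy only \<open>f i m \<le> g m\<close>, then \<open>f i (r n)\<close> is bounded
  by \<open>r (n + 2)\<close>, one block too late. Choosing \<open>g\<close> undominated by the twofold iterates of the \<open>f i\<close>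
  corrects this: either \<open>f i m\<close> stays below \<open>r (n + 1)\<close> and the block at \<open>n\<close> is long enough for \<open>i\<close>,
  or \<open>f i m\<close> lies beyond \<open>r (n + 1)\<close> and the block at \<open>n + 1\<close> is.
\<close>

lemma guessable_interval_partition:
  fixes f :: "'i \<Rightarrow> nat \<Rightarrow> nat"
  assumes "guessable (I \<times> (UNIV :: nat set))"
  shows "\<exists>r. strict_mono r \<and> (\<forall>i\<in>I. infinite {n. f i (r n) \<le> r (Suc n)})"
proof -
  \<comment> \<open>The argument compares values at different places, so it needs monotone majorants.\<close>
  define F where "F i n = (\<Sum>k\<le>n. f i k)" for i n
  have f_le_F: "f i n \<le> F i n" for i n
    unfolding F_def by (rule member_le_sum) auto
  have F_mono: "F i m \<le> F i n" if "m \<le> n" for i m n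
    unfolding F_def using that by (intro sum_mono2) auto
  obtain g where g: "\<And>i. i \<in> I \<Longrightarrow> infinite {n. F i (F i n) \<le> g n}"
    using guessable_undominated[OF assms, of "\<lambda>i n. F i (F i n)"] by blast
  define G where "G n = (\<Sum>k\<le>n. g k) + Suc n" for n
  have g_le_G: "g m \<le> G n" if "m \<le> n" for m n
  proof -
    have "g m \<le> (\<Sum>k\<le>n. g k)"
      by (rule member_le_sum) (use that in auto)
    then show ?thesis
      by (simp add: G_def)
  qed
  define r where "r n = (G ^^ n) 0" for n
  have r0: "r 0 = 0" and r_Suc: "r (Suc n) = G (r n)" for n
    by (simp_all add: r_def)
  have r: "strict_mono r"
    by (rule strict_monoI_Suc) (simp add: r_Suc G_def)
  have "\<exists>n\<ge>M. f i (r n) \<le> r (Suc n)" if "i \<in> I" for i M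
  proof -
    obtain m where m: "r M \<le> m" "F i (F i m) \<le> g m"
      using g[OF \<open>i \<in> I\<close>] unfolding infinite_nat_iff_unbounded_le by blast
    have "\<exists>k. m < r k"
      using strict_mono_imp_increasing[OF r, of "Suc m"] by (intro exI[of _ "Suc m"]) simp
    then obtain k where k: "m < r k" "\<And>j. j < k \<Longrightarrow> \<not> m < r j"
      using exists_least_iff[of "\<lambda>k. m < r k"] by blast
    then obtain n where n: "k = Suc n"
      using r0 by (cases k) auto
    have mn: "r n \<le> m" "m < r (Suc n)"
      using k n by (auto simp: not_less)
    have "M \<le> n"
      using m(1) mn(2) strict_mono_less[OF r] by (metis le_less_trans less_Suc_eq_le)
    show ?thesis
    proof (cases "F i m \<le> r (Suc n)")
      case True
      then have "f i (r n) \<le> r (Suc n)"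
        using f_le_F[of i "r n"] F_mono[OF mn(1), of i] by linarith
      with \<open>M \<le> n\<close> show ?thesis
        by blast
    next
      case False
      then have "F i (r (Suc n)) \<le> F i (F i m)"
        by (intro F_mono) simp
      then have "f i (r (Suc n)) \<le> r (Suc (Suc n))"
        using f_le_F[of i "r (Suc n)"] m(2) g_le_G[of m "r (Suc n)"] mn(2)
        by (simp add: r_Suc[of "Suc n"])
      with \<open>M \<le> n\<close> show ?thesis
        by (meson le_Suc_eq)
    qed
  qed
  then have "\<forall>i\<in>I. infinite {n. f i (r n) \<le> r (Suc n)}"
    by (auto simp: infinite_nat_iff_unbounded_le)
  with r show ?thesis
    by blast
qed

section \<open>Guessing inside prescribed infinite sets\<close>

text \<open>
  The \<open>n\<close>-th guess is made for the restriction of \<open>f i\<close> to the first \<open>n + 1\<close> elements of \<open>S i\<close>. It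
  offers \<open>n + 1\<close> arguments, at most \<open>n\<close> of which were used for earlier guesses; so one pair of an
  argument and a value can be extracted from every guess with no two of them in conflict. When the
  \<open>n\<close>-th guess is right for \<open>i\<close>, the pair extracted is a point of the graph of \<open>f i\<close> over \<open>S i\<close>.
\<close>

lemma guessable_on_infinite_sets:
  fixes f :: "'i \<Rightarrow> nat \<Rightarrow> 'v::countable"
  assumes "guessable I" and inf: "\<And>i. i \<in> I \<Longrightarrow> infinite (S i)"
  shows "\<exists>g. \<forall>i\<in>I. \<exists>n\<in>S i. f i n = g n"
proof -
  define L where "L i n = map (\<lambda>k. (k, f i k)) (map (enumerate (S i)) [0..<Suc n])" for i n
  obtain h where h: "\<forall>i\<in>I. \<exists>n. L i n = h n"
    using guessable_countable_values[OF assms(1), of L] by blast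
  \<comment> \<open>A guess with too few arguments is wrong for every \<open>i\<close>; an unused argument is then spent on it
    so that \<open>fst \<circ> p\<close> is injective without exceptions.\<close>
  define P where "P p n q \<longleftrightarrow> fst q \<notin> fst ` p ` {..<n} \<and>
      (n < card (fst ` set (h n)) \<longrightarrow> q \<in> set (h n))"
    for p :: "nat \<Rightarrow> nat \<times> 'v" and n q
  have "\<exists>p. \<forall>n. P p n (p n)"
  proof (rule dependent_wellorder_choice)
    fix q n and p p' :: "nat \<Rightarrow> nat \<times> 'v"
    assume "\<And>m. m < n \<Longrightarrow> p m = p' m"
    then have "p ` {..<n} = p' ` {..<n}"
      by (intro image_cong) auto
    then show "P p n q = P p' n q"
      by (simp add: P_def)
  next
    fix n and p :: "nat \<Rightarrow> nat \<times> 'v"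
    let ?used = "fst ` p ` {..<n}"
    have card_used: "card ?used \<le> n"
      using card_image_le[of "{..<n}" "fst \<circ> p"] by (simp add: image_comp)
    show "\<exists>q. P p n q"
    proof (cases "n < card (fst ` set (h n))")
      case True
      then have "\<not> fst ` set (h n) \<subseteq> ?used"
        using card_used card_mono[of ?used "fst ` set (h n)"] by auto
      then show ?thesis
        unfolding P_def by blast
    next
      case False
      obtain k where "k \<notin> ?used"
        using ex_new_if_finite[of ?used] by auto
      then have "P p n (k, undefined)"
        using False unfolding P_def by (metis fst_conv)
      then show ?thesis ..
    qed
  qed
  then obtain p where p: "\<And>n. P p n (p n)"
    by blast
  have inj: "inj (fst \<circ> p)"
  proof (rule linorder_injI)
    fix m n :: nat
    assume "m < n"
    then show "(fst \<circ> p) m \<noteq> (fst \<circ> p) n"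
      using p[of n] unfolding P_def by (metis comp_apply imageI lessThan_iff)
  qed
  define g where "g k = snd (p (inv (fst \<circ> p) k))" for k
  have "\<exists>k\<in>S i. f i k = g k" if "i \<in> I" for i
  proof -
    obtain n where n: "L i n = h n"
      using h \<open>i \<in> I\<close> by blast
    have "fst ` set (h n) = enumerate (S i) ` {0..<Suc n}"
      by (simp add: n[symmetric] L_def image_image del: upt_Suc)
    moreover have "inj (enumerate (S i))"
      using strict_mono_enumerate[OF inf[OF \<open>i \<in> I\<close>]] by (rule strict_mono_imp_inj_on)
    ultimately have "card (fst ` set (h n)) = Suc n"
      by (simp add: card_image inj_on_subset)
    then have "p n \<in> set (L i n)"
      using p[of n] n unfolding P_def by simp
    then obtain k where k: "k \<in> S i" "p n = (k, f i k)"
      using enumerate_in_set[OF inf[OF \<open>i \<in> I\<close>]] by (auto simp: L_def)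
    have "inv (fst \<circ> p) k = n"
      using inj k(2) by (metis comp_apply fst_conv inv_f_f)
    then have "g k = f i k"
      by (simp add: g_def k(2))
    with k(1) show ?thesis
      by force
  qed
  then show ?thesis
    by blast
qed

section \<open>Nowhere dense sets and dyadic intervals\<close>

text \<open>
  For \<open>k < 2 ^ n\<close>, this is the set of numbers in the unit interval that have a binary expansion
  beginning with the \<open>n\<close> digits of \<open>k\<close>. Appending the \<open>m\<close> digits of \<open>t < 2 ^ m\<close> turns \<open>k\<close> into
  \<open>k * 2 ^ m + t\<close>.
\<close>

definition dyadic :: "nat \<Rightarrow> nat \<Rightarrow> real set" where
  "dyadic k n = {real k / 2 ^ n .. (real k + 1) / 2 ^ n}"

lemma dyadic_nested:
  assumes "t < 2 ^ m"
  shows "dyadic (k * 2 ^ m + t) (n + m) \<subseteq> dyadic k n"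
proof -
  have "real t + 1 \<le> 2 ^ m"
    using assms by (metis Suc_leI add.commute of_nat_Suc of_nat_le_iff of_nat_numeral of_nat_power)
  then have "(real t + 1) * 2 ^ n \<le> 2 ^ m * 2 ^ n"
    by (rule mult_right_mono) simp
  then have "real k / 2 ^ n \<le> real (k * 2 ^ m + t) / 2 ^ (n + m)"
    "(real (k * 2 ^ m + t) + 1) / 2 ^ (n + m) \<le> (real k + 1) / 2 ^ n"
    by (simp_all add: power_add field_simps)
  then show ?thesis
    by (auto simp: dyadic_def)
qed

lemma nowhere_dense_avoid_dyadic:
  assumes "nowhere_dense_in euclidean B"
  shows "\<exists>m t. t < 2 ^ m \<and> dyadic (k * 2 ^ m + t) (n + m) \<inter> B = {}"
proof -
  let ?J = "{real k / 2 ^ n <..< (real k + 1) / 2 ^ n}"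
  have "interior (closure B) = {}"
    using assms by (simp add: nowhere_dense_in_def)
  moreover have "?J \<noteq> {}"
    using divide_strict_right_mono[of "real k" "real k + 1" "2 ^ n"] by simp
  ultimately have "\<not> ?J \<subseteq> closure B"
    using interior_maximal[of ?J "closure B"] by auto
  then obtain x where x: "x \<in> ?J" "x \<notin> closure B"
    by blast
  then obtain e where e: "e > 0" "ball x e \<inter> closure B = {}"
    using open_contains_ball[of "- closure B"] by (auto simp: disjoint_eq_subset_Compl)
  obtain m where "(1 / 2 :: real) ^ m < e"
    using real_arch_pow_inv[OF e(1), of "1 / 2"] by auto
  moreover have "(1 / 2 :: real) ^ (n + m) \<le> (1 / 2) ^ m"
    by (rule power_decreasing) auto
  ultimately have small: "1 / 2 ^ (n + m) < e"
    by (simp add: power_one_over)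
  define j where "j = nat \<lfloor>x * 2 ^ (n + m)\<rfloor>"
  have x0: "0 \<le> x"
    using x(1) by (auto intro: order_trans[of 0 "real k / 2 ^ n" x])
  have j: "real j \<le> x * 2 ^ (n + m)" "x * 2 ^ (n + m) < real j + 1"
    using x0 by (auto simp: j_def floor_le_iff)
  have "real k < x * 2 ^ n" "x * 2 ^ n < real k + 1"
    using x(1) by (auto simp: field_simps)
  then have "real k * 2 ^ m < x * 2 ^ n * 2 ^ m" "x * 2 ^ n * 2 ^ m < (real k + 1) * 2 ^ m"
    by (simp_all only: mult_strict_right_mono zero_less_power zero_less_numeral)
  then have "real k * 2 ^ m < x * 2 ^ (n + m)" "x * 2 ^ (n + m) < (real k + 1) * 2 ^ m"
    by (simp_all only: power_add mult.assoc)
  then have "real (k * 2 ^ m) < real (j + 1)" "real j < real ((k + 1) * 2 ^ m)"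
    using j by (auto simp: algebra_simps)
  then have "k * 2 ^ m < j + 1" "j < (k + 1) * 2 ^ m"
    by (simp_all only: of_nat_less_iff)
  then have t: "j - k * 2 ^ m < 2 ^ m" "k * 2 ^ m + (j - k * 2 ^ m) = j"
    by (auto simp: algebra_simps)
  have "dyadic j (n + m) \<subseteq> ball x e"
  proof
    fix y assume "y \<in> dyadic j (n + m)"
    then have "real j / 2 ^ (n + m) \<le> y" "y \<le> real j / 2 ^ (n + m) + 1 / 2 ^ (n + m)"
      by (auto simp: dyadic_def add_divide_distrib)
    moreover have "real j / 2 ^ (n + m) \<le> x" "x < real j / 2 ^ (n + m) + 1 / 2 ^ (n + m)"
      using j by (auto simp: field_simps)
    ultimately show "y \<in> ball x e"
      using small by (simp add: dist_real_def abs_less_iff)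
  qed
  then have "dyadic j (n + m) \<inter> B = {}"
    using e(2) closure_subset[of B] by blast
  with t show ?thesis
    by metis
qed

text \<open>
  One string of digits serves all \<open>k < N\<close> at once: the string for \<open>k < N\<close> is prolonged to one that
  works for \<open>N\<close> as well, and prolonging only shrinks the intervals already avoiding \<open>B\<close>.
\<close>

lemma nowhere_dense_avoid_dyadics:
  assumes B: "nowhere_dense_in euclidean B"
  shows "\<exists>m t. t < 2 ^ m \<and> (\<forall>k<N. dyadic (k * 2 ^ m + t) (n + m) \<inter> B = {})"
proof (induction N)
  case 0
  show ?case
    by (intro exI[of _ 0]) simp
next
  case (Suc N)
  then obtain m t where t: "t < 2 ^ m"
    and old: "\<And>k. k < N \<Longrightarrow> dyadic (k * 2 ^ m + t) (n + m) \<inter> B = {}"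
    by blast
  obtain m' t' where t': "t' < 2 ^ m'"
    and new: "dyadic ((N * 2 ^ m + t) * 2 ^ m' + t') (n + m + m') \<inter> B = {}"
    using nowhere_dense_avoid_dyadic[OF B] by blast
  have "dyadic ((k * 2 ^ m + t) * 2 ^ m' + t') (n + m + m') \<inter> B = {}" if "k < Suc N" for k
    using old[of k] new dyadic_nested[OF t', of "k * 2 ^ m + t" "n + m"] that
    by (cases "k = N") auto
  moreover have "(k * 2 ^ m + t) * 2 ^ m' + t' = k * 2 ^ (m + m') + (t * 2 ^ m' + t')" for k
    by (simp add: power_add algebra_simps)
  moreover have "t * 2 ^ m' + t' < 2 ^ (m + m')"
  proof -
    have "t * 2 ^ m' + t' < Suc t * 2 ^ m'"
      using t' by simp
    also have "\<dots> \<le> 2 ^ m * 2 ^ m'"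
      using t by (intro mult_right_mono) auto
    finally show ?thesis
      by (simp add: power_add)
  qed
  ultimately show ?case
    by (metis add.assoc)
qed

section \<open>Guessable families of nowhere dense sets do not cover the line\<close>

lemma guessable_nowhere_dense_not_cover:
  fixes J :: "real set set"
  assumes guess: "guessable (J \<times> (UNIV :: nat set))"
    and nd: "\<And>B. B \<in> J \<Longrightarrow> nowhere_dense_in euclidean B"
  shows "\<Union>J \<noteq> UNIV"
proof -
  have "\<forall>B n. \<exists>m t. B \<in> J \<longrightarrow>
      t < 2 ^ m \<and> (\<forall>k<2 ^ n. dyadic (k * 2 ^ m + t) (n + m) \<inter> B = {})"
    using nowhere_dense_avoid_dyadics[OF nd] by blast
  then obtain m t where t: "\<And>B n. B \<in> J \<Longrightarrow> t B n < 2 ^ m B n"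
    and avoid: "\<And>B n k. B \<in> J \<Longrightarrow> k < 2 ^ n \<Longrightarrow>
      dyadic (k * 2 ^ m B n + t B n) (n + m B n) \<inter> B = {}"
    by metis
  obtain r where r: "strict_mono r"
    and inf: "\<And>B. B \<in> J \<Longrightarrow> infinite {n. r n + m B (r n) \<le> r (Suc n)}"
    using guessable_interval_partition[OF guess, of "\<lambda>B n. n + m B n"] by blast
  define len where "len n = r (Suc n) - r n" for n
  have r_Suc: "r (Suc n) = r n + len n" for n
    using strict_mono_less[OF r, of n "Suc n"] by (simp add: len_def)
  have "guessable J"
    using guess by (rule guessable_card_le) (simp add: card_of_Times1)
  then obtain v where v: "\<And>B. B \<in> J \<Longrightarrow>
      \<exists>n. r n + m B (r n) \<le> r (Suc n) \<and> t B (r n) * 2 ^ (len n - m B (r n)) = v n"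
    using guessable_on_infinite_sets[OF _ inf, of J "\<lambda>B. B"
        "\<lambda>B n. t B (r n) * 2 ^ (len n - m B (r n))"] by auto
  \<comment> \<open>\<open>a n\<close> holds the first \<open>r n\<close> digits of the real under construction. The string \<open>t B (r n)\<close> was
    padded with zeros to fill its block; reduction modulo \<open>2 ^ len n\<close> affects wrong guesses only.\<close>
  define a where "a = rec_nat 0 (\<lambda>n x. x * 2 ^ len n + v n mod 2 ^ len n)"
  have a_Suc: "a (Suc n) = a n * 2 ^ len n + v n mod 2 ^ len n" for n
    by (simp add: a_def)
  have a_less: "a n < 2 ^ r n" for n
  proof (induction n)
    case 0
    show ?case
      by (simp add: a_def)
  next
    case (Suc n)
    have "a (Suc n) < Suc (a n) * 2 ^ len n"
      by (simp add: a_Suc)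
    also have "\<dots> \<le> 2 ^ r n * 2 ^ len n"
      using Suc by (intro mult_right_mono) auto
    finally show ?case
      by (simp add: r_Suc power_add)
  qed
  have "dyadic (a (Suc n)) (r (Suc n)) \<subseteq> dyadic (a n) (r n)" for n
    unfolding a_Suc r_Suc by (rule dyadic_nested) simp
  then have "dyadic (a n) (r n) \<subseteq> dyadic (a l) (r l)" if "l \<le> n" for l n
    using lift_Suc_antimono_le[of "\<lambda>n. dyadic (a n) (r n)"] that by blast
  then have "\<Inter>(range (\<lambda>n. dyadic (a n) (r n))) \<noteq> {}"
    by (intro compact_nest) (auto simp: dyadic_def divide_right_mono)
  then obtain y where y: "\<And>n. y \<in> dyadic (a n) (r n)"
    by auto
  have "y \<notin> B" if B: "B \<in> J" for B
  proof -
    obtain n where n: "r n + m B (r n) \<le> r (Suc n)"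
      "t B (r n) * 2 ^ (len n - m B (r n)) = v n"
      using v[OF B] by blast
    define d where "d = len n - m B (r n)"
    have len: "len n = m B (r n) + d"
      using n(1) by (simp add: d_def r_Suc)
    have "v n < 2 ^ len n"
      using t[OF B, of "r n"] n(2)[symmetric] by (simp add: len power_add)
    then have "a (Suc n) = (a n * 2 ^ m B (r n) + t B (r n)) * 2 ^ d + 0"
      using n(2) by (simp add: a_Suc) (simp add: len power_add algebra_simps)
    then have "dyadic (a (Suc n)) (r (Suc n)) \<subseteq>
        dyadic (a n * 2 ^ m B (r n) + t B (r n)) (r n + m B (r n))"
      using dyadic_nested[of 0 d "a n * 2 ^ m B (r n) + t B (r n)" "r n + m B (r n)"]
      by (simp add: r_Suc len add.assoc)
    then show ?thesis
      using y[of "Suc n"] avoid[OF B a_less[of n]] by blast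
  qed
  then show ?thesis
    by blast
qed

section \<open>Selective spaces are guessable\<close>

lemma R_nw_selective_guessable:
  assumes "R_nw_selective X"
  shows "guessable (topspace X)"
  unfolding guessable_def
proof
  fix f :: "'a \<Rightarrow> nat \<Rightarrow> nat"
  obtain \<N> where \<N>: "countable \<N>" "network X \<N>"
    using assms by (auto simp: R_nw_selective_def)
  define \<F> where "\<F> n = (\<lambda>(N, v). {x \<in> N. f x n = v}) ` (\<N> \<times> UNIV)" for n
  have "countable (\<F> n)" for n
    using \<N>(1) by (simp add: \<F>_def)
  moreover have "network X (\<F> n)" for n
    unfolding network_def
  proof (intro conjI ballI allI impI)
    fix M assume "M \<in> \<F> n"
    then show "M \<subseteq> topspace X"
      using \<N>(2) by (auto simp: \<F>_def network_def)
  next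
    fix x V assume x: "x \<in> topspace X" "openin X V \<and> x \<in> V"
    then obtain N where "N \<in> \<N>" "x \<in> N" "N \<subseteq> V"
      using \<N>(2) unfolding network_def by meson
    then show "\<exists>M\<in>\<F> n. x \<in> M \<and> M \<subseteq> V"
      by (intro bexI[of _ "{y \<in> N. f y n = f x n}"]) (auto simp: \<F>_def)
  qed
  ultimately obtain M where M: "\<And>n. M n \<in> \<F> n" "network X (range M)"
    using assms unfolding R_nw_selective_def by (elim conjE allE[of _ \<F>]) auto
  have "\<forall>n. \<exists>v. M n \<subseteq> {x. f x n = v}"
    using M(1) by (fastforce simp: \<F>_def)
  then obtain g where g: "\<And>n. M n \<subseteq> {x. f x n = g n}"
    by metis
  have "\<exists>n. f x n = g n" if "x \<in> topspace X" for x
  proof -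
    have "openin X (topspace X) \<and> x \<in> topspace X"
      using that by simp
    then obtain n where "x \<in> M n"
      using M(2) that unfolding network_def by blast
    then show ?thesis
      using g by blast
  qed
  then show "\<exists>g. \<forall>x\<in>topspace X. \<exists>n. f x n = g n"
    by blast
qed

section \<open>Spaces of size at least the covering number of the meager ideal\<close>

theorem proposition2p7:
  fixes X :: "'a topology"
  assumes "cov_meager \<le>o |topspace X|"
  shows "\<not> R_nw_selective X"
proof
  assume "R_nw_selective X"
  then have guess: "guessable (topspace X)"
    by (rule R_nw_selective_guessable)
  obtain U where U: "meager_cover U" "cov_meager = |U|"
    using cov_meager_attained by blast
  have U_le: "|U| \<le>o |topspace X|"
    using assms U(2) by simp
  have "\<forall>A\<in>U. \<exists>F. countable F \<and> (\<forall>B\<in>F. nowhere_dense_in euclidean B) \<and> A = \<Union>F"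
    using U(1) by (simp add: meager_cover_def meager_in_def)
  then obtain F where F: "\<And>A. A \<in> U \<Longrightarrow> countable (F A)"
      "\<And>A B. A \<in> U \<Longrightarrow> B \<in> F A \<Longrightarrow> nowhere_dense_in euclidean B"
      "\<And>A. A \<in> U \<Longrightarrow> A = \<Union>(F A)"
    by metis
  define J where "J = (\<Union>A\<in>U. F A)"
  have "guessable (J \<times> (UNIV :: nat set))"
  proof (cases "finite (topspace X)")
    case True
    then have "finite U"
      using U_le card_of_ordLeq_finite by blast
    then have "countable J"
      unfolding J_def using F(1) by (intro countable_UN) (auto intro: countable_finite)
    then show ?thesis
      by (intro guessable_countable) simp
  next
    case False
    then have nat_le: "|UNIV :: nat set| \<le>o |topspace X|"
      by (simp add: infinite_iff_card_of_nat)
    have "|F A| \<le>o |topspace X|" if "A \<in> U" for A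
      using F(1)[OF that] nat_le ordLeq_transitive unfolding countable_card_of_nat by blast
    then have "|J| \<le>o |topspace X|"
      unfolding J_def using False U_le by (intro card_of_UNION_ordLeq_infinite) auto
    then have "|J \<times> (UNIV :: nat set)| \<le>o |topspace X|"
      using False nat_le by (intro card_of_Sigma_ordLeq_infinite) auto
    then show ?thesis
      using guess guessable_card_le by blast
  qed
  then have "\<Union>J \<noteq> UNIV"
    by (rule guessable_nowhere_dense_not_cover) (auto simp: J_def F(2))
  moreover have "\<Union>J = \<Union>U"
    using F(3) unfolding J_def by blast
  ultimately show False
    using U(1) by (simp add: meager_cover_def)
qed

end
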